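(* Let $q$ be an odd prime power and $n\ge3$ with $(q^n-1)/2$ even, and let $Q=(q^n-1)/(q-1)$. For every divisor $m$ of $Q$, $$\mathcal{N}_0(m)\ \ge\ \theta(m)\,q^{\frac n2-1}\Big\{q^{\frac n2}-2W(m)(q-1)\Big\}.$$ Consequently, if $q^{n/2}>2W(Q)(q-1)$, then $\mathcal{N}_0(q^n-1)>0$.
   Context: For a divisor $m$ of $q^n-1$, an element $\xi\in\mathbb{F}_{q^n}^*$ is $m$-free if $\xi=\zeta^d$ with $d\mid m$ and $\zeta\in\mathbb{F}_{q^n}^*$ implies $d=1$. For $\beta\in\mathbb{F}_q$, $\mathcal{N}_\beta(m)$ denotes the number of $m$-free $\xi\in\mathbb{F}_{q^n}^*$ with $\mathrm{Tr}(\xi^2)=\beta$, where $\mathrm{Tr}(\xi)=\sum_{i=0}^{n-1}\xi^{q^i}\in\mathbb{F}_q$. $\theta(m)=\phi(m)/m$ and $W(t)$ is the number of square-free divisors of $t$. *)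

theory Defs
  imports Complex_Main "HOL-Library.Cardinality" "HOL-Computational_Algebra.Computational_Algebra"
    "HOL-Number_Theory.Number_Theory"
begin

text \<open>
  The field with \<open>q ^ n\<close> elements is a type of class \<^class>\<open>finite_field\<close> whose cardinality
  is \<open>q ^ n\<close>. Its subfield of order \<open>q\<close> is the set of \<open>x\<close> with \<open>x ^ q = x\<close>, so the
  trace to that subfield takes values in the same type.
\<close>

definition field_trace :: "nat \<Rightarrow> nat \<Rightarrow> 'a::finite_field \<Rightarrow> 'a" where
  "field_trace q n x = (\<Sum>i<n. x ^ (q ^ i))"

definition free_elem :: "nat \<Rightarrow> 'a::finite_field \<Rightarrow> bool" where
  "free_elem m \<xi> \<longleftrightarrow> \<xi> \<noteq> 0 \<and> (\<forall>d \<zeta>. d dvd m \<and> \<zeta> \<noteq> 0 \<and> \<xi> = \<zeta> ^ d \<longrightarrow> d = 1)"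

definition num_free_trace_sq :: "nat \<Rightarrow> nat \<Rightarrow> 'a::finite_field \<Rightarrow> nat \<Rightarrow> nat" where
  "num_free_trace_sq q n \<beta> m = card {\<xi>::'a. free_elem m \<xi> \<and> field_trace q n (\<xi>\<^sup>2) = \<beta>}"

definition theta :: "nat \<Rightarrow> real" where
  "theta m = real (totient m) / real m"

definition num_squarefree_divisors :: "nat \<Rightarrow> nat" where
  "num_squarefree_divisors t = card {d. d dvd t \<and> squarefree d}"

end

theory Submission
  imports Defs
begin

text \<open>
  Let \<open>T\<close> be the set of nonzero elements of trace zero. Two linear forms \<open>c \<mapsto> Tr (c y)\<close> and
  \<open>c \<mapsto> Tr (c z)\<close> have \<open>q ^ (n - 2)\<close> common zeros, or \<open>q ^ (n - 1)\<close> if \<open>z / y\<close> lies in the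
  subfield. Hence, for a function \<open>f\<close> with zero sum, the squared sums of \<open>f\<close> over the dilates
  \<open>c T\<close> add up to at most \<open>q ^ (n - 2) (q - 1)\<^sup>2 \<Sum> |f|\<^sup>2\<close>; no additive characters are needed.
  For \<open>f y = \<Sum> \<chi> x\<close> over the square roots \<open>x\<close> of \<open>y\<close>, the sums over the dilates by squares
  all have the same modulus, and since squaring is at most two-to-one this bounds
  \<open>\<Sum> \<chi> x\<close> over \<open>Tr (x\<^sup>2) = 0\<close> by \<open>2 (q - 1) q ^ (n / 2 - 1)\<close> for every nontrivial character \<open>\<chi>\<close>.
  The indicator of the \<open>m\<close>-free elements is \<open>\<theta> m\<close> times a product over the primes \<open>p\<close> dividing
  \<open>m\<close> of \<open>1\<close> plus a combination, of total weight one, of the characters of order \<open>p\<close>. Expanding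
  it gives one main term and, for each nonempty set of primes, an average of nontrivial
  character sums.
\<close>

subsection \<open>Generators and characters of a finite field\<close>

text \<open>Cyclicity of the multiplicative group is known for structures with a carrier, so the
  type is repackaged as the record \<open>R\<close>. The order of \<open>g\<close> is the size of
  the group it generates, which is all \<open>CARD('a) - 1\<close> nonzero elements.\<close>

lemma finite_field_has_generator:
  obtains g :: "'a::finite_field"
  where "g \<noteq> 0" and "\<And>x. x \<noteq> 0 \<Longrightarrow> \<exists>k. x = g ^ k"
    and "\<And>k. g ^ k = 1 \<longleftrightarrow> CARD('a) - 1 dvd k"
proof -
  define R :: "'a ring" where
    "R = \<lparr>carrier = UNIV, mult = (*), one = 1, zero = 0, add = (+)\<rparr>"
  interpret R: field R
  proof unfold_locales
    have "\<exists>y\<in>carrier R. y \<oplus>\<^bsub>R\<^esub> x = \<zero>\<^bsub>R\<^esub> \<and> x \<oplus>\<^bsub>R\<^esub> y = \<zero>\<^bsub>R\<^esub>" for x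
      by (rule bexI[of _ "- x"]) (auto simp: R_def)
    hence "x \<in> Units (add_monoid R)" for x
      by (auto simp: Units_def R_def)
    thus "carrier (add_monoid R) \<subseteq> Units (add_monoid R)" by blast
    show "Units R = carrier R - {\<zero>\<^bsub>R\<^esub>}"
    proof (intro equalityI subsetI)
      fix x assume "x \<in> carrier R - {\<zero>\<^bsub>R\<^esub>}"
      hence "x * inverse x = 1" by (simp add: R_def)
      thus "x \<in> Units R"
        unfolding Units_def by (auto simp: R_def mult.commute)
    qed (auto simp: R_def Units_def)
  qed (auto simp: R_def algebra_simps)
  have pow: "x [^]\<^bsub>R\<^esub> k = x ^ k" for x and k :: nat
  proof (induction k)
    case 0 show ?case by (simp add: R.nat_pow_0) (simp add: R_def)
  next
    case (Suc k) thus ?case by (simp add: R.nat_pow_Suc) (simp add: R_def mult.commute)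
  qed
  have fin: "finite (carrier R)" by (simp add: R_def)
  have mult_of: "carrier (mult_of R) = UNIV - {0}" by (simp add: carrier_mult_of) (simp add: R_def)
  obtain g where g: "g \<in> carrier (mult_of R)"
    and gen: "carrier (mult_of R) = {g [^]\<^bsub>R\<^esub> i | i :: nat. i \<in> UNIV}"
    using R.finite_field_mult_group_has_gen[OF fin] by blast
  interpret M: group "mult_of R" by (rule R.field_mult_group)
  have finM: "finite (carrier (mult_of R))" using mult_of by simp
  have "M.ord g = card (generate (mult_of R) {g})"
    by (rule M.generate_pow_card[OF g])
  also have "generate (mult_of R) {g} = carrier (mult_of R)"
    using gen by (simp add: M.generate_pow_on_finite_carrier[OF finM g] nat_pow_mult_of)
  also have "card \<dots> = CARD('a) - 1"
    unfolding mult_of by (simp add: card_Diff_singleton)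
  finally have ord: "M.ord g = CARD('a) - 1" .
  show thesis
  proof (rule that[of g])
    show "g \<noteq> 0" using g mult_of by auto
    show "\<exists>k. x = g ^ k" if "x \<noteq> 0" for x
      using gen that mult_of pow by auto
    show "g ^ k = 1 \<longleftrightarrow> CARD('a) - 1 dvd k" for k
      using M.pow_eq_id[OF g, of k] ord pow[of g k]
      by (simp add: nat_pow_mult_of) (simp add: R_def)
  qed
qed

text \<open>A generator is sent to a primitive root of unity of order \<open>CARD('a) - 1\<close>.
  Powers of this one character supply every character used later; its value at \<open>0\<close> is
  unspecified.\<close>

lemma finite_field_has_faithful_character:
  obtains \<chi> :: "'a::finite_field \<Rightarrow> complex"
  where "\<And>x y. x \<noteq> 0 \<Longrightarrow> y \<noteq> 0 \<Longrightarrow> \<chi> (x * y) = \<chi> x * \<chi> y"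
    and "\<And>x. x \<noteq> 0 \<Longrightarrow> cmod (\<chi> x) = 1"
    and "\<And>x. x \<noteq> 0 \<Longrightarrow> \<chi> x = 1 \<longleftrightarrow> x = 1"
proof -
  obtain g :: 'a where g: "g \<noteq> 0" "\<And>x. x \<noteq> 0 \<Longrightarrow> \<exists>k. x = g ^ k"
    "\<And>k. g ^ k = 1 \<longleftrightarrow> CARD('a) - 1 dvd k"
    using finite_field_has_generator by metis
  define N where "N = CARD('a) - 1"
  have "card {0, 1 :: 'a} \<le> CARD('a)" by (rule card_mono) auto
  hence N: "N > 0" by (simp add: N_def)
  define \<omega> where "\<omega> = cis (2 * pi / real N)"
  have \<omega>1: "\<omega> ^ k = 1 \<longleftrightarrow> N dvd k" for k
  proof -
    have pw: "\<omega> ^ k = cis (2 * pi * (real k / real N))"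
      by (simp add: \<omega>_def DeMoivre mult.commute)
    show ?thesis
    proof
      assume "\<omega> ^ k = 1"
      hence "cos (2 * pi * (real k / real N)) = 1" by (simp add: pw complex_eq_iff)
      then obtain j :: int where "2 * pi * (real k / real N) = real_of_int j * 2 * pi"
        by (auto simp: cos_one_2pi_int)
      hence "real k = real_of_int j * real N" using N by (simp add: field_simps)
      hence "int k = j * int N" by (metis of_int_eq_iff of_int_mult of_int_of_nat_eq)
      thus "N dvd k" by (metis dvd_triv_right int_dvd_int_iff)
    next
      assume "N dvd k"
      then obtain j where "k = N * j" ..
      hence "real k / real N = real j" using N by simp
      thus "\<omega> ^ k = 1" using cis_multiple_2pi[of "real j"] unfolding pw by simp
    qed
  qed
  \<comment> \<open>\<open>l\<close> is a discrete logarithm, determined only modulo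
    \<open>N\<close>; \<open>eqI\<close> shows that \<open>\<omega> ^ l x\<close> does not depend on
    the choice.\<close>
  define l where "l = (\<lambda>x. SOME k. x = g ^ k)"
  have l: "g ^ l x = x" if "x \<noteq> 0" for x
    using someI_ex[OF g(2)[OF that]] by (simp add: l_def)
  have eqI: "\<omega> ^ a = \<omega> ^ b" if "g ^ a = g ^ b" for a b
    using that
  proof (induction a b rule: linorder_wlog)
    case (le a b)
    hence "g ^ (b - a) = 1" using g(1) by (simp add: power_diff)
    hence "\<omega> ^ (b - a) = 1" using g(3) \<omega>1 by (simp add: N_def)
    thus ?case using le by (metis mult.right_neutral le_add_diff_inverse power_add)
  qed simp
  show thesis
  proof (rule that[of "\<lambda>x. \<omega> ^ l x"])
    show "\<omega> ^ l (x * y) = \<omega> ^ l x * \<omega> ^ l y" if "x \<noteq> 0" "y \<noteq> 0" for x y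
      using eqI[of "l (x * y)" "l x + l y"] that by (simp add: l power_add)
    show "cmod (\<omega> ^ l x) = 1" for x by (simp add: \<omega>_def norm_power)
    show "\<omega> ^ l x = 1 \<longleftrightarrow> x = 1" if "x \<noteq> 0" for x
      using \<omega>1[of "l x"] g(3)[of "l x"] l[OF that] by (simp add: N_def)
  qed
qed

text \<open>The fibres of \<open>h\<close> on \<open>S\<close> are translates of its kernel in
  \<open>S\<close>. A subset \<open>S\<close> is allowed because the trace forms are later
  restricted to the kernel of another one.\<close>

lemma card_eq_card_image_times_card_kernel:
  fixes h :: "'a::ab_group_add \<Rightarrow> 'b::ab_group_add"
  assumes "finite S" and diff: "\<And>x y. x \<in> S \<Longrightarrow> y \<in> S \<Longrightarrow> x - y \<in> S"
    and add: "\<And>x y. x \<in> S \<Longrightarrow> y \<in> S \<Longrightarrow> x + y \<in> S"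
    and hom: "\<And>x y. h (x + y) = h x + h y"
  shows "card S = card (h ` S) * card {x \<in> S. h x = 0}"
proof -
  have "card S = (\<Sum>v\<in>h ` S. card {x \<in> S. h x = v})"
    using \<open>finite S\<close> sum.image_gen[of S "\<lambda>_. 1::nat" h] by simp
  also have "\<dots> = (\<Sum>v\<in>h ` S. card {x \<in> S. h x = 0})"
  proof (intro sum.cong refl)
    fix v assume "v \<in> h ` S"
    then obtain a where a: "a \<in> S" "v = h a" by blast
    have hd: "h (x - a) = h x - h a" for x using hom[of "x - a" a] by (simp add: algebra_simps)
    have "bij_betw (\<lambda>x. x + a) {x \<in> S. h x = 0} {x \<in> S. h x = v}"
      by (rule bij_betwI[of _ _ _ "\<lambda>x. x - a"]) (auto simp: a hom hd add diff)
    thus "card {x \<in> S. h x = v} = card {x \<in> S. h x = 0}" by (rule bij_betw_same_card[symmetric])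
  qed
  finally show ?thesis by simp
qed

subsection \<open>The trace to the subfield of order q\<close>

locale finite_extension =
  fixes q n :: nat and ty :: "'a::finite_field itself"
  assumes primepow_q: "primepow q" and n_ge_2: "n \<ge> 2" and card_UNIV: "CARD('a) = q ^ n"
begin

abbreviation tr :: "'a \<Rightarrow> 'a" where
  "tr \<equiv> field_trace q n"

definition base :: "'a set" where
  "base = {x. x ^ q = x}"

lemma q_gt_1: "q > 1"
  using primepow_q primepow_gt_Suc_0 by auto

text \<open>The characteristic is a prime dividing a power of \<open>p\<close>, hence equals
  \<open>p\<close>, and \<open>x \<mapsto> x ^ (q ^ i)\<close> is an iterated Frobenius map.\<close>

lemma power_q_power_add: "(x + y :: 'a) ^ (q ^ i) = x ^ (q ^ i) + y ^ (q ^ i)"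
proof -
  obtain p k where pk: "prime p" "k > 0" "q = p ^ k"
    using primepow_q by (auto simp: primepow_def)
  have "CHAR('a) dvd p ^ (k * n)"
    using CHAR_dvd_CARD[where ?'a = 'a] card_UNIV pk by (simp add: power_mult)
  hence "CHAR('a) dvd p" using CHAR_prime prime_dvd_power by blast
  hence "CHAR('a) = p" using pk(1) CHAR_prime primes_dvd_imp_eq by blast
  thus ?thesis using freshmans_dream'[of "q ^ i" "k * i" x y] pk
    by (simp add: power_mult)
qed

lemma zero_in_base: "0 \<in> base" and one_in_base: "1 \<in> base"
  using q_gt_1 by (auto simp: base_def)

lemma mult_in_base: "x \<in> base \<Longrightarrow> y \<in> base \<Longrightarrow> x * y \<in> base"
  by (simp add: base_def power_mult_distrib)

lemma inverse_in_base: "x \<in> base \<Longrightarrow> inverse x \<in> base"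
  by (simp add: base_def power_inverse)

lemma base_power_q_power: "x \<in> base \<Longrightarrow> x ^ (q ^ i) = x"
  by (induction i) (auto simp: base_def power_mult)

lemma tr_add: "tr (x + y) = tr x + tr y"
  by (simp add: field_trace_def power_q_power_add sum.distrib)

lemma tr_0: "tr 0 = 0"
  by (metis add_cancel_right_right tr_add)

lemma tr_diff: "tr (x - y) = tr x - tr y"
  using tr_add[of "x - y" y] by (simp add: algebra_simps)

lemma tr_base_mult: "c \<in> base \<Longrightarrow> tr (c * x) = c * tr x"
  by (simp add: field_trace_def power_mult_distrib base_power_q_power sum_distrib_left)

text \<open>Raising to the power \<open>q\<close> shifts the conjugates cyclically, because
  \<open>x ^ (q ^ n) = x\<close>.\<close>

lemma tr_in_base: "tr x \<in> base"
proof -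
  have pow_sum: "(\<Sum>i<m. f i) ^ q = (\<Sum>i<m. f i ^ q)" for f :: "nat \<Rightarrow> 'a" and m
    using q_gt_1 power_q_power_add[of _ _ 1] by (induction m) auto
  have "tr x ^ q = (\<Sum>i<n. x ^ (q ^ Suc i))"
    by (simp add: field_trace_def pow_sum flip: power_mult) (simp add: mult.commute)
  also have "\<dots> + x ^ (q ^ 0) = (\<Sum>i<Suc n. x ^ (q ^ i))"
    by (subst sum.lessThan_Suc_shift) (simp add: add.commute)
  also have "\<dots> = tr x + x ^ (q ^ n)" by (simp add: field_trace_def)
  also have "x ^ (q ^ n) = x"
    using finite_field_power_card_eq_same[of x] card_UNIV by simp
  finally show ?thesis by (simp add: base_def)
qed

lemma card_base_le: "card base \<le> q"
proof -
  \<comment> \<open>The elements of \<open>base\<close> are the roots of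
    \<open>X ^ q - X\<close>.\<close>
  define f :: "'a poly" where "f = Polynomial.monom 1 q + [:0, -1:]"
  have "degree f = q" unfolding f_def using q_gt_1
    by (subst degree_add_eq_left) (auto simp: degree_monom_eq)
  hence "f \<noteq> 0" using q_gt_1 by auto
  moreover have "base \<subseteq> {x. poly f x = 0}" by (auto simp: base_def f_def poly_monom)
  ultimately show ?thesis
    using \<open>degree f = q\<close> card_mono[of "{x. poly f x = 0}" base] card_poly_roots_bound[of f]
    by simp
qed

lemma card_kernel_tr_le: "card {x. tr x = 0} \<le> q ^ (n - 1)"
proof -
  define f :: "'a poly" where "f = (\<Sum>i<n. Polynomial.monom 1 (q ^ i))"
  have le: "degree f \<le> q ^ (n - 1)"
    unfolding f_def using q_gt_1
    by (intro degree_sum_le) (auto simp: degree_monom_eq intro!: power_increasing)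
  \<comment> \<open>Only \<open>i = 0\<close> gives the exponent 1, so the trace polynomial has
    linear coefficient 1 and is nonzero.\<close>
  have "Polynomial.coeff f 1 = (\<Sum>i<n. if i = 0 then 1 else 0)"
    unfolding f_def coeff_sum using q_gt_1
    by (intro sum.cong) (auto simp: power_eq_1_iff)
  also have "\<dots> = 1" using n_ge_2 by simp
  finally have "f \<noteq> 0" by auto
  moreover have "{x. tr x = 0} = {x. poly f x = 0}"
    by (auto simp: f_def poly_sum poly_monom field_trace_def)
  ultimately show ?thesis using card_poly_roots_bound[of f] le by simp
qed

text \<open>
  The kernel and the image of the trace are roots of polynomials of degrees \<open>q ^ (n - 1)\<close> and
  \<open>q\<close>, and their sizes multiply to \<open>q ^ n\<close>, so both root bounds are attained.
\<close>

lemma card_kernel_tr: "card {x. tr x = 0} = q ^ (n - 1)"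
  and card_base: "card base = q"
  and range_tr: "range tr = base"
proof -
  have eq: "q ^ n = card (range tr) * card {x. tr x = 0}"
    using card_eq_card_image_times_card_kernel[of UNIV tr] card_UNIV by (simp add: tr_add)
  have sub: "range tr \<subseteq> base" using tr_in_base by auto
  have a: "card (range tr) \<le> card base" by (rule card_mono) (use sub in auto)
  have qn: "q ^ n = q * q ^ (n - 1)" using n_ge_2 by (cases n) auto
  have pos: "q ^ (n - 1) > 0" using q_gt_1 by simp
  have b: "card (range tr) \<ge> q"
  proof (rule ccontr)
    assume "\<not> card (range tr) \<ge> q"
    hence "card (range tr) * card {x. tr x = 0} < q * q ^ (n - 1)"
      using card_kernel_tr_le pos by (intro mult_less_le_imp_less) (auto simp: card_gt_0_iff intro: tr_0)
    thus False using eq qn by simp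
  qed
  have c: "card (range tr) = q" "card base = q" using a b card_base_le by auto
  show "card base = q" by fact
  show "card {x. tr x = 0} = q ^ (n - 1)" using eq qn c q_gt_1 by simp
  show "range tr = base" using sub c by (intro card_subset_eq) auto
qed

section \<open>Common zeros of two trace forms\<close>

definition trace_kernel :: "'a \<Rightarrow> 'a set" where
  "trace_kernel y = {c. tr (c * y) = 0}"

lemma card_trace_kernel: 
  assumes "y \<noteq> 0"
  shows "card (trace_kernel y) = q ^ (n - 1)"
proof -
  have "bij_betw (\<lambda>c. c * y) (trace_kernel y) {x. tr x = 0}"
    by (rule bij_betwI[of _ _ _ "\<lambda>c. c / y"]) (use assms in \<open>auto simp: trace_kernel_def\<close>)
  thus ?thesis using card_kernel_tr bij_betw_same_card by metis
qed

text \<open>Nondegeneracy of the trace form, from surjectivity: for \<open>y \<noteq> 0\<close> the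
  multiplier \<open>x / y\<close> reaches an \<open>x\<close> of trace 1.\<close>

lemma tr_mult_eq_0_iff: "(\<forall>c. tr (c * y) = 0) \<longleftrightarrow> y = 0"
proof
  assume *: "\<forall>c. tr (c * y) = 0"
  show "y = 0"
  proof (rule ccontr)
    assume "y \<noteq> 0"
    obtain x where "tr x = 1" using range_tr one_in_base by (metis imageE)
    thus False using *[rule_format, of "x / y"] \<open>y \<noteq> 0\<close> by simp
  qed
qed (simp add: tr_0)

lemma trace_kernel_base_mult:
  assumes "t \<in> base" "t \<noteq> 0"
  shows "trace_kernel (t * y) = trace_kernel y"
  using assms by (simp add: trace_kernel_def mult.left_commute[of _ t] tr_base_mult)

text \<open>Linear forms over \<open>base\<close> with nested kernels are proportional, and
  nondegeneracy carries the factor over to \<open>y\<close> and \<open>z\<close>.\<close>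

lemma trace_kernel_subset_imp:
  assumes "y \<noteq> 0" "trace_kernel y \<subseteq> trace_kernel z"
  shows "\<exists>t\<in>base. z = t * y"
proof -
  obtain x where "tr x = 1" using range_tr one_in_base by (metis imageE)
  define c0 where "c0 = x / y"
  have c0: "tr (c0 * y) = 1" using assms \<open>tr x = 1\<close> by (simp add: c0_def)
  define t where "t = tr (c0 * z)"
  have t: "t \<in> base" by (simp add: t_def tr_in_base)
  have "tr (c * (z - t * y)) = 0" for c
  proof -
    have s: "tr (c * y) \<in> base" by (rule tr_in_base)
    \<comment> \<open>Since \<open>tr (c0 * y) = 1\<close>, subtracting this multiple of
      \<open>c0\<close> moves \<open>c\<close> into the kernel for \<open>y\<close>, which lies in
      the kernel for \<open>z\<close>.\<close>
    have "tr ((c - tr (c * y) * c0) * y) = 0"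
      using tr_base_mult[OF s, of "c0 * y"] c0 by (simp add: tr_diff algebra_simps)
    hence "tr ((c - tr (c * y) * c0) * z) = 0" using assms by (auto simp: trace_kernel_def)
    hence "tr (c * z) = tr (c * y) * t"
      using tr_base_mult[OF s, of "c0 * z"] by (simp add: tr_diff algebra_simps t_def)
    moreover have "tr (c * (t * y)) = t * tr (c * y)"
      using tr_base_mult[OF t, of "c * y"] by (simp add: mult.left_commute)
    ultimately show ?thesis by (simp add: tr_diff right_diff_distrib mult.commute)
  qed
  hence "z = t * y" using tr_mult_eq_0_iff[of "z - t * y"] by simp
  thus ?thesis using t by blast
qed

text \<open>The form of \<open>z\<close> does not vanish on the kernel for \<open>y\<close>, so by
  linearity it maps that kernel onto \<open>base\<close>; its zeros there are fewer by the factor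
  \<open>q\<close>.\<close>

lemma card_trace_kernel_Int:
  assumes "y \<noteq> 0" "z \<noteq> 0" "z / y \<notin> base"
  shows "card (trace_kernel y \<inter> trace_kernel z) = q ^ (n - 2)"
proof -
  let ?h = "\<lambda>c. tr (c * z)"
  have "?h ` trace_kernel y = base"
  proof
    show "?h ` trace_kernel y \<subseteq> base" using tr_in_base by auto
    have "\<not> trace_kernel y \<subseteq> trace_kernel z"
      using trace_kernel_subset_imp[of y z] assms by auto
    then obtain c where c: "tr (c * y) = 0" "tr (c * z) \<noteq> 0"
      by (auto simp: trace_kernel_def)
    show "base \<subseteq> ?h ` trace_kernel y"
    proof
      fix v assume v: "v \<in> base"
      define s where "s = v / tr (c * z)"
      have s: "s \<in> base" unfolding s_def divide_inverse
        by (intro mult_in_base inverse_in_base v tr_in_base)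
      have "s * c \<in> trace_kernel y" "tr (s * c * z) = v"
        using tr_base_mult[OF s, of "c * y"] tr_base_mult[OF s, of "c * z"] c
        by (auto simp: trace_kernel_def s_def mult.assoc)
      thus "v \<in> ?h ` trace_kernel y" by force
    qed
  qed
  moreover have "card (trace_kernel y) = card (?h ` trace_kernel y) * card {x \<in> trace_kernel y. ?h x = 0}"
    by (rule card_eq_card_image_times_card_kernel)
       (auto simp: trace_kernel_def tr_add tr_diff algebra_simps)
  moreover have "{x \<in> trace_kernel y. ?h x = 0} = trace_kernel y \<inter> trace_kernel z"
    by (auto simp: trace_kernel_def)
  moreover have "q * q ^ (n - 2) = q ^ (n - 1)"
    using n_ge_2 by (simp add: Suc_diff_Suc numeral_2_eq_2 flip: power_Suc)
  ultimately have "q * q ^ (n - 2) = q * card (trace_kernel y \<inter> trace_kernel z)"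
    using card_trace_kernel[of y] card_base assms by simp
  thus ?thesis using q_gt_1 by simp
qed

end

section \<open>Second moment over the dilates of the trace-zero set\<close>

lemma norm_sum_mult_cnj_scale_le:
  fixes f :: "'a::finite_field \<Rightarrow> complex"
  assumes "t \<noteq> 0"
  shows "cmod (\<Sum>y\<in>UNIV - {0}. f y * cnj (f (t * y))) \<le> (\<Sum>y\<in>UNIV - {0}. (cmod (f y))\<^sup>2)"
proof -
  have "cmod (\<Sum>y\<in>UNIV - {0}. f y * cnj (f (t * y)))
          \<le> (\<Sum>y\<in>UNIV - {0}. ((cmod (f y))\<^sup>2 + (cmod (f (t * y)))\<^sup>2) / 2)"
  proof (intro sum_norm_le)
    \<comment> \<open>The arithmetic-geometric mean inequality suffices, as both squares have the
      same total: \<open>y \<mapsto> t * y\<close> permutes the nonzero elements.\<close>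
    show "cmod (f y * cnj (f (t * y))) \<le> ((cmod (f y))\<^sup>2 + (cmod (f (t * y)))\<^sup>2) / 2" for y
      using sum_squares_bound[of "cmod (f y)" "cmod (f (t * y))"] by (simp add: norm_mult)
  qed
  also have "\<dots> = ((\<Sum>y\<in>UNIV - {0}. (cmod (f y))\<^sup>2) + (\<Sum>y\<in>UNIV - {0}. (cmod (f (t * y)))\<^sup>2)) / 2"
    by (simp add: sum.distrib flip: sum_divide_distrib)
  also have "(\<Sum>y\<in>UNIV - {0}. (cmod (f (t * y)))\<^sup>2) = (\<Sum>y\<in>UNIV - {0}. (cmod (f y))\<^sup>2)"
    by (rule sum.reindex_bij_witness[of _ "\<lambda>y. y / t" "\<lambda>y. t * y"]) (use assms in auto)
  finally show ?thesis by simp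
qed

context finite_extension
begin

definition trace_zero :: "'a set" where
  "trace_zero = {y. y \<noteq> 0 \<and> tr y = 0}"

text \<open>The \<open>- 1\<close> removes \<open>c = 0\<close>. The generic count is split off as a
  constant, which cancels against functions of zero sum; the excess for proportional
  \<open>y\<close> and \<open>z\<close> is what remains.\<close>

lemma card_common_trace_kernel:
  assumes "y \<noteq> 0" "z \<noteq> 0"
  shows "real (card {c \<in> UNIV - {0}. tr (c * y) = 0 \<and> tr (c * z) = 0}) =
    (real q ^ (n - 2) - 1) + (if z / y \<in> base then real q ^ (n - 2) * (real q - 1) else 0)"
proof -
  let ?I = "trace_kernel y \<inter> trace_kernel z"
  have eq: "{c \<in> UNIV - {0}. tr (c * y) = 0 \<and> tr (c * z) = 0} = ?I - {0}"
    by (auto simp: trace_kernel_def)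
  have 0: "0 \<in> ?I" by (simp add: trace_kernel_def tr_0)
  hence "card ?I > 0" by (auto simp: card_gt_0_iff)
  hence "real (card (?I - {0})) = real (card ?I) - 1"
    using 0 by (simp add: card_Diff_singleton of_nat_diff)
  moreover have "card ?I = (if z / y \<in> base then q ^ (n - 1) else q ^ (n - 2))"
  proof (cases "z / y \<in> base")
    case True
    hence "trace_kernel z = trace_kernel y"
      using trace_kernel_base_mult[of "z / y" y] assms by simp
    thus ?thesis using True card_trace_kernel[of y] assms by simp
  qed (use card_trace_kernel_Int assms in auto)
  moreover have "real q ^ (n - 1) = real q ^ (n - 2) * real q"
    using n_ge_2 by (simp add: Suc_diff_Suc numeral_2_eq_2 flip: power_Suc2)
  ultimately show ?thesis unfolding eq by (simp add: algebra_simps)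
qed

text \<open>Opening the square pairs \<open>y\<close> with \<open>z\<close>. The excess in the count
  of common zeros leaves correlations of \<open>f\<close> with its dilates by the
  \<open>q - 1\<close> nonzero elements of \<open>base\<close>, each at most the sum of squares;
  hence the second factor \<open>q - 1\<close>.\<close>

lemma trace_zero_second_moment:
  fixes f :: "'a \<Rightarrow> complex"
  assumes sum0: "(\<Sum>y\<in>UNIV - {0}. f y) = 0"
  shows "(\<Sum>c\<in>UNIV - {0}. (cmod (\<Sum>y\<in>trace_zero. f (c * y)))\<^sup>2)
           \<le> real q ^ (n - 2) * (real q - 1)\<^sup>2 * (\<Sum>y\<in>UNIV - {0}. (cmod (f y))\<^sup>2)"
proof -
  define U where "U = (UNIV - {0} :: 'a set)"
  define w :: "'a \<Rightarrow> 'a \<Rightarrow> complex" where "w = (\<lambda>c y. if tr (c * y) = 0 then 1 else 0)"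
  define b where "b = real q ^ (n - 2) - 1"
  define a where "a = real q ^ (n - 2) * (real q - 1)"
  have a: "a \<ge> 0" using q_gt_1 by (simp add: a_def)
  have shift: "(\<Sum>y\<in>trace_zero. f (c * y)) = (\<Sum>y\<in>U. w (inverse c) y * f y)" if "c \<in> U" for c
  proof -
    have "(\<Sum>y\<in>trace_zero. f (c * y)) = (\<Sum>y\<in>{y \<in> U. tr (inverse c * y) = 0}. f y)"
      by (rule sum.reindex_bij_witness[of _ "\<lambda>y. inverse c * y" "\<lambda>y. c * y"])
         (use that in \<open>auto simp: U_def trace_zero_def simp flip: mult.assoc\<close>)
    also have "\<dots> = (\<Sum>y\<in>U. w (inverse c) y * f y)"
      by (rule sum.mono_neutral_cong_left) (auto simp: w_def U_def)
    finally show ?thesis .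
  qed
  have w_sum: "(\<Sum>c\<in>U. w c y * w c z) = of_real (b + (if z / y \<in> base then a else 0))"
    if "y \<in> U" "z \<in> U" for y z
  proof -
    have "(\<Sum>c\<in>U. w c y * w c z) = of_nat (card {c \<in> U. tr (c * y) = 0 \<and> tr (c * z) = 0})"
    proof -
      have "(\<Sum>c\<in>U. w c y * w c z) = (\<Sum>c\<in>{c \<in> U. tr (c * y) = 0 \<and> tr (c * z) = 0}. 1)"
        by (rule sum.mono_neutral_cong_right) (auto simp: w_def)
      thus ?thesis by simp
    qed
    also have "\<dots> = of_real (real (card {c \<in> U. tr (c * y) = 0 \<and> tr (c * z) = 0}))" by simp
    also have "real (card {c \<in> U. tr (c * y) = 0 \<and> tr (c * z) = 0}) =
        b + (if z / y \<in> base then a else 0)"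
      using card_common_trace_kernel[of y z] that unfolding U_def a_def b_def by simp
    finally show ?thesis .
  qed
  define F where "F = (\<Sum>c\<in>U. (cmod (\<Sum>y\<in>trace_zero. f (c * y)))\<^sup>2)"
  have "F = (\<Sum>c\<in>U. (cmod (\<Sum>y\<in>U. w (inverse c) y * f y))\<^sup>2)"
    by (simp add: F_def shift)
  also have "\<dots> = (\<Sum>c\<in>U. (cmod (\<Sum>y\<in>U. w c y * f y))\<^sup>2)"
    by (rule sum.reindex_bij_witness[of _ inverse inverse]) (auto simp: U_def)
  finally have "complex_of_real F = (\<Sum>c\<in>U. (\<Sum>y\<in>U. w c y * f y) * cnj (\<Sum>z\<in>U. w c z * f z))"
    by (simp only: of_real_sum complex_norm_square)
  also have "\<dots> = (\<Sum>c\<in>U. \<Sum>y\<in>U. \<Sum>z\<in>U. w c y * w c z * (f y * cnj (f z)))"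
    by (auto simp: sum_product w_def intro!: sum.cong)
  also have "\<dots> = (\<Sum>y\<in>U. \<Sum>c\<in>U. \<Sum>z\<in>U. w c y * w c z * (f y * cnj (f z)))"
    by (rule sum.swap)
  also have "\<dots> = (\<Sum>y\<in>U. \<Sum>z\<in>U. \<Sum>c\<in>U. w c y * w c z * (f y * cnj (f z)))"
    by (intro sum.cong refl sum.swap)
  also have "\<dots> = (\<Sum>y\<in>U. \<Sum>z\<in>U. of_real b * (f y * cnj (f z)) +
                     (if z / y \<in> base then of_real a * (f y * cnj (f z)) else 0))"
    by (intro sum.cong refl, subst sum_distrib_right[symmetric], subst w_sum)
       (auto simp: algebra_simps)
  also have "\<dots> = (\<Sum>y\<in>U. \<Sum>z\<in>U. of_real b * (f y * cnj (f z))) +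
      (\<Sum>y\<in>U. \<Sum>z\<in>U. if z / y \<in> base then of_real a * (f y * cnj (f z)) else 0)"
    by (simp only: sum.distrib)
  \<comment> \<open>This part factors through the sum of \<open>f\<close>, which is zero by
    \<open>sum0\<close>.\<close>
  also have "(\<Sum>y\<in>U. \<Sum>z\<in>U. of_real b * (f y * cnj (f z))) =
      of_real b * ((\<Sum>y\<in>U. f y) * cnj (\<Sum>z\<in>U. f z))"
    unfolding cnj_sum sum_product by (simp only: sum_distrib_left)
  also have "(\<Sum>y\<in>U. \<Sum>z\<in>U. if z / y \<in> base then of_real a * (f y * cnj (f z)) else 0) =
      of_real a * (\<Sum>y\<in>U. \<Sum>z\<in>U. if z / y \<in> base then f y * cnj (f z) else 0)"
    unfolding sum_distrib_left by (intro sum.cong refl) simp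
  \<comment> \<open>Substitution \<open>z = t * y\<close> with \<open>t\<close> a nonzero element of
    the subfield.\<close>
  also have "(\<Sum>y\<in>U. \<Sum>z\<in>U. if z / y \<in> base then f y * cnj (f z) else 0) =
             (\<Sum>y\<in>U. \<Sum>t\<in>base - {0}. f y * cnj (f (t * y)))"
  proof (rule sum.cong[OF refl])
    fix y assume y: "y \<in> U"
    have "(\<Sum>z\<in>U. if z / y \<in> base then f y * cnj (f z) else 0) =
          (\<Sum>z\<in>{z \<in> U. z / y \<in> base}. f y * cnj (f z))"
      by (rule sum.inter_filter[symmetric]) simp
    also have "\<dots> = (\<Sum>t\<in>base - {0}. f y * cnj (f (t * y)))"
      by (rule sum.reindex_bij_witness[of _ "\<lambda>t. t * y" "\<lambda>z. z / y"])
         (use y in \<open>auto simp: U_def\<close>)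
    finally show "(\<Sum>z\<in>U. if z / y \<in> base then f y * cnj (f z) else 0) =
          (\<Sum>t\<in>base - {0}. f y * cnj (f (t * y)))" .
  qed
  also have "\<dots> = (\<Sum>t\<in>base - {0}. \<Sum>y\<in>U. f y * cnj (f (t * y)))"
    by (rule sum.swap)
  finally have "complex_of_real F = of_real a * (\<Sum>t\<in>base - {0}. \<Sum>y\<in>U. f y * cnj (f (t * y)))"
    using sum0 by (simp add: U_def)
  hence "\<bar>F\<bar> = a * cmod (\<Sum>t\<in>base - {0}. \<Sum>y\<in>U. f y * cnj (f (t * y)))"
    using a by (metis abs_of_nonneg norm_mult norm_of_real)
  also have "\<dots> \<le> a * (\<Sum>t\<in>base - {0}. \<Sum>y\<in>U. (cmod (f y))\<^sup>2)"
    using a unfolding U_def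
    by (intro mult_left_mono sum_norm_le norm_sum_mult_cnj_scale_le) auto
  also have "\<dots> = a * ((real q - 1) * (\<Sum>y\<in>U. (cmod (f y))\<^sup>2))"
    using zero_in_base card_base q_gt_1 by (simp add: card_Diff_singleton of_nat_diff)
  finally show ?thesis unfolding F_def U_def a_def by (simp add: power2_eq_square algebra_simps)
qed

end

subsection \<open>Sums over the zeros of the trace of the square\<close>

lemma sum_nontrivial_character_eq_0:
  fixes \<chi> :: "'a::finite_field \<Rightarrow> complex"
  assumes mult: "\<And>x y. x \<noteq> 0 \<Longrightarrow> y \<noteq> 0 \<Longrightarrow> \<chi> (x * y) = \<chi> x * \<chi> y"
    and "a \<noteq> 0" "\<chi> a \<noteq> 1"
  shows "(\<Sum>x\<in>UNIV - {0}. \<chi> x) = 0"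
proof -
  have "(\<Sum>x\<in>UNIV - {0}. \<chi> x) = (\<Sum>x\<in>UNIV - {0}. \<chi> (a * x))"
    by (rule sum.reindex_bij_witness[of _ "\<lambda>x. a * x" "\<lambda>x. x / a"]) (use assms in auto)
  also have "\<dots> = \<chi> a * (\<Sum>x\<in>UNIV - {0}. \<chi> x)"
    using assms by (simp add: sum_distrib_left)
  finally show ?thesis using assms by simp
qed

definition nonzero_sqrts :: "'a::finite_field \<Rightarrow> 'a set" where
  "nonzero_sqrts y = {x. x \<noteq> 0 \<and> x\<^sup>2 = y}"

lemma card_nonzero_sqrts_le: "card (nonzero_sqrts y) \<le> 2"
proof (cases "nonzero_sqrts y = {}")
  case False
  then obtain x where "x\<^sup>2 = y" by (auto simp: nonzero_sqrts_def)
  hence "nonzero_sqrts y \<subseteq> {x, - x}" by (auto simp: nonzero_sqrts_def power2_eq_iff)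
  hence "card (nonzero_sqrts y) \<le> card {x, - x}" by (intro card_mono) auto
  also have "\<dots> \<le> 2" by (simp add: card_insert_if)
  finally show ?thesis .
qed simp

lemma sum_nonzero_sqrts_scale:
  assumes "b \<noteq> 0"
  shows "(\<Sum>x\<in>nonzero_sqrts (b\<^sup>2 * y). g x) = (\<Sum>x\<in>nonzero_sqrts y. g (b * x))"
  by (rule sum.reindex_bij_witness[of _ "\<lambda>x. b * x" "\<lambda>x. x / b"])
     (use assms in \<open>auto simp: nonzero_sqrts_def power_mult_distrib power_divide\<close>)

text \<open>The fibres of squaring partition the preimage of \<open>A\<close>; \<open>A\<close> must
  avoid \<open>0\<close> because the root \<open>0\<close> is left out of the fibres.\<close>

lemma sum_over_nonzero_sqrts:
  fixes g :: "'a::finite_field \<Rightarrow> 'b::comm_monoid_add"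
  assumes "0 \<notin> A"
  shows "(\<Sum>y\<in>A. \<Sum>x\<in>nonzero_sqrts y. g x) = (\<Sum>x\<in>{x. x\<^sup>2 \<in> A}. g x)"
proof -
  have "(\<Sum>x\<in>{x. x\<^sup>2 \<in> A}. g x) = (\<Sum>y\<in>A. \<Sum>x\<in>{x \<in> {x. x\<^sup>2 \<in> A}. x\<^sup>2 = y}. g x)"
    by (rule sum.group[symmetric]) auto
  also have "\<dots> = (\<Sum>y\<in>A. \<Sum>x\<in>nonzero_sqrts y. g x)"
    by (intro sum.cong refl) (use assms in \<open>auto simp: nonzero_sqrts_def\<close>)
  finally show ?thesis ..
qed

lemma sum_over_all_nonzero_sqrts:
  fixes g :: "'a::finite_field \<Rightarrow> 'b::comm_monoid_add"
  shows "(\<Sum>y\<in>UNIV - {0}. \<Sum>x\<in>nonzero_sqrts y. g x) = (\<Sum>x\<in>UNIV - {0}. g x)"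
proof -
  have "{x :: 'a. x\<^sup>2 \<in> UNIV - {0}} = UNIV - {0}" by auto
  thus ?thesis using sum_over_nonzero_sqrts[of "UNIV - {0}" g] by simp
qed

context finite_extension
begin

lemma card_nonzero: "card (UNIV - {0} :: 'a set) = q ^ n - 1"
  using card_UNIV by (simp add: card_Diff_singleton)

lemma card_nonzero_pos: "q ^ n - 1 > 0"
  using one_less_power[OF q_gt_1, of n] n_ge_2 by simp

text \<open>By \<open>inv\<close> every dilate by a square contributes the same amount, so the
  second moment contains this value \<open>q ^ n - 1\<close> times once each \<open>c\<close> is
  counted at most twice, as \<open>b\<close> and \<open>- b\<close>. This costs the factor 2;
  \<open>C\<close> bounds the mean square of \<open>f\<close>.\<close>

lemma trace_zero_sum_le:
  fixes f :: "'a \<Rightarrow> complex"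
  assumes sum0: "(\<Sum>y\<in>UNIV - {0}. f y) = 0"
    and inv: "\<And>b. b \<noteq> 0 \<Longrightarrow> cmod (\<Sum>y\<in>trace_zero. f (b\<^sup>2 * y)) = cmod (\<Sum>y\<in>trace_zero. f y)"
    and bound: "(\<Sum>y\<in>UNIV - {0}. (cmod (f y))\<^sup>2) \<le> C * real (q ^ n - 1)"
  shows "(cmod (\<Sum>y\<in>trace_zero. f y))\<^sup>2 \<le> 2 * C * (real q ^ (n - 2) * (real q - 1)\<^sup>2)"
proof -
  define G where "G c = (cmod (\<Sum>y\<in>trace_zero. f (c * y)))\<^sup>2" for c
  define D where "D = real q ^ (n - 2) * (real q - 1)\<^sup>2"
  have D: "D \<ge> 0" by (simp add: D_def)
  have "real (q ^ n - 1) * (cmod (\<Sum>y\<in>trace_zero. f y))\<^sup>2 = (\<Sum>b\<in>UNIV - {0}. G (b\<^sup>2))"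
    using inv card_nonzero by (simp add: G_def)
  also have "\<dots> = (\<Sum>c\<in>UNIV - {0}. \<Sum>b\<in>nonzero_sqrts c. G (b\<^sup>2))"
    by (rule sum_over_all_nonzero_sqrts[symmetric])
  also have "\<dots> \<le> (\<Sum>c\<in>UNIV - {0}. 2 * G c)"
  proof (rule sum_mono)
    fix c
    have "(\<Sum>b\<in>nonzero_sqrts c. G (b\<^sup>2)) = real (card (nonzero_sqrts c)) * G c"
      by (simp add: nonzero_sqrts_def)
    also have "\<dots> \<le> 2 * G c"
      using card_nonzero_sqrts_le[of c] by (intro mult_right_mono) (auto simp: G_def)
    finally show "(\<Sum>b\<in>nonzero_sqrts c. G (b\<^sup>2)) \<le> 2 * G c" .
  qed
  also have "\<dots> = 2 * (\<Sum>c\<in>UNIV - {0}. G c)" by (simp add: sum_distrib_left)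
  also have "\<dots> \<le> 2 * (D * (\<Sum>y\<in>UNIV - {0}. (cmod (f y))\<^sup>2))"
    unfolding G_def D_def using trace_zero_second_moment[OF sum0] by simp
  also have "\<dots> \<le> 2 * (D * (C * real (q ^ n - 1)))"
    using bound D by (intro mult_left_mono) auto
  finally have "real (q ^ n - 1) * (cmod (\<Sum>y\<in>trace_zero. f y))\<^sup>2 \<le> real (q ^ n - 1) * (2 * C * D)"
    by (simp only: mult_ac)
  moreover have "real (q ^ n - 1) > 0"
    by (simp only: of_nat_0_less_iff card_nonzero_pos)
  ultimately have "(cmod (\<Sum>y\<in>trace_zero. f y))\<^sup>2 \<le> 2 * C * D"
    by (simp only: mult_le_cancel_left_pos)
  thus ?thesis by (simp only: D_def)
qed

definition square_trace_zero :: "'a set" where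
  "square_trace_zero = {x. x \<noteq> 0 \<and> tr (x\<^sup>2) = 0}"

lemma sum_trace_zero_nonzero_sqrts:
  "(\<Sum>y\<in>trace_zero. \<Sum>x\<in>nonzero_sqrts y. g x) = (\<Sum>x\<in>square_trace_zero. g x)"
  by (subst sum_over_nonzero_sqrts)
     (auto simp: trace_zero_def square_trace_zero_def intro!: sum.cong)

lemma sum_real_card_nonzero_sqrts:
  "(\<Sum>y\<in>UNIV - {0}. real (card (nonzero_sqrts (y::'a)))) = real (q ^ n - 1)"
  using sum_over_all_nonzero_sqrts[of "\<lambda>_::'a. 1 :: real"] card_nonzero by simp

lemma square_trace_zero_character_sum_le:
  fixes \<chi> :: "'a \<Rightarrow> complex"
  assumes mult: "\<And>x y. x \<noteq> 0 \<Longrightarrow> y \<noteq> 0 \<Longrightarrow> \<chi> (x * y) = \<chi> x * \<chi> y"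
    and norm: "\<And>x. x \<noteq> 0 \<Longrightarrow> cmod (\<chi> x) = 1"
    and nontriv: "a \<noteq> 0" "\<chi> a \<noteq> 1"
  shows "(cmod (\<Sum>x\<in>square_trace_zero. \<chi> x))\<^sup>2 \<le> 4 * (real q ^ (n - 2) * (real q - 1)\<^sup>2)"
proof -
  define f where "f y = (\<Sum>x\<in>nonzero_sqrts y. \<chi> x)" for y
  have "(cmod (\<Sum>y\<in>trace_zero. f y))\<^sup>2 \<le> 2 * 2 * (real q ^ (n - 2) * (real q - 1)\<^sup>2)"
  proof (rule trace_zero_sum_le)
    show "(\<Sum>y\<in>UNIV - {0}. f y) = 0"
      unfolding f_def sum_over_all_nonzero_sqrts
      by (rule sum_nontrivial_character_eq_0[OF mult nontriv])
    show "cmod (\<Sum>y\<in>trace_zero. f (b\<^sup>2 * y)) = cmod (\<Sum>y\<in>trace_zero. f y)" if "b \<noteq> 0" for b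
    proof -
      have "f (b\<^sup>2 * y) = \<chi> b * f y" for y
        unfolding f_def sum_nonzero_sqrts_scale[OF that] sum_distrib_left
        by (intro sum.cong refl mult that) (auto simp: nonzero_sqrts_def)
      thus ?thesis using norm[OF that] by (simp add: norm_mult flip: sum_distrib_left)
    qed
    \<comment> \<open>With \<open>r \<le> 2\<close> roots, the square is at most
      \<open>r * r \<le> 2 * r\<close>, and the \<open>r\<close> add up to \<open>q ^ n - 1\<close>.
      So \<open>C = 2\<close>.\<close>
    have "(cmod (f y))\<^sup>2 \<le> 2 * real (card (nonzero_sqrts y))" for y
    proof -
      have "cmod (f y) \<le> (\<Sum>x\<in>nonzero_sqrts y. 1)"
        unfolding f_def by (rule sum_norm_le) (auto simp: nonzero_sqrts_def norm)
      hence "(cmod (f y))\<^sup>2 \<le> (real (card (nonzero_sqrts y)))\<^sup>2"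
        by (intro power_mono) auto
      also have "\<dots> \<le> 2 * real (card (nonzero_sqrts y))"
        unfolding power2_eq_square using card_nonzero_sqrts_le[of y]
        by (intro mult_right_mono) auto
      finally show ?thesis .
    qed
    hence "(\<Sum>y\<in>UNIV - {0}. (cmod (f y))\<^sup>2) \<le> (\<Sum>y\<in>UNIV - {0}. 2 * real (card (nonzero_sqrts (y::'a))))"
      by (intro sum_mono) auto
    also have "\<dots> = 2 * real (q ^ n - 1)"
      by (simp add: sum_real_card_nonzero_sqrts flip: sum_distrib_left)
    finally show "(\<Sum>y\<in>UNIV - {0}. (cmod (f y))\<^sup>2) \<le> 2 * real (q ^ n - 1)" .
  qed
  thus ?thesis by (simp add: f_def sum_trace_zero_nonzero_sqrts)
qed

lemma card_trace_zero: "real (card trace_zero) = real q ^ (n - 1) - 1"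
proof -
  have "trace_zero = {y. tr y = 0} - {0}" by (auto simp: trace_zero_def)
  thus ?thesis using card_kernel_tr tr_0 q_gt_1 by (simp add: card_Diff_singleton of_nat_diff)
qed

text \<open>The same method applied to the number of square roots minus its mean 1, a function
  bounded by 1, so \<open>C = 1\<close>. The resulting constant 2, against 4 for characters, leaves
  room to absorb the \<open>- 1\<close> later.\<close>

lemma card_square_trace_zero_approx:
  "(real (card square_trace_zero) - (real q ^ (n - 1) - 1))\<^sup>2 \<le> 2 * (real q ^ (n - 2) * (real q - 1)\<^sup>2)"
proof -
  define r where "r y = real (card (nonzero_sqrts y))" for y :: 'a
  have "(cmod (\<Sum>y\<in>trace_zero. of_real (r y - 1)))\<^sup>2 \<le> 2 * 1 * (real q ^ (n - 2) * (real q - 1)\<^sup>2)"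
  proof (rule trace_zero_sum_le)
    have "(\<Sum>y\<in>UNIV - {0}. r y - 1) = 0"
      using card_nonzero by (simp add: sum_subtractf r_def sum_real_card_nonzero_sqrts)
    thus "(\<Sum>y\<in>UNIV - {0}. complex_of_real (r y - 1)) = 0"
      by (metis of_real_0 of_real_sum)
    show "cmod (\<Sum>y\<in>trace_zero. of_real (r (b\<^sup>2 * y) - 1)) = cmod (\<Sum>y\<in>trace_zero. of_real (r y - 1))"
      if "b \<noteq> 0" for b
      using sum_nonzero_sqrts_scale[OF that, where g = "\<lambda>_. 1 :: real"] by (simp add: r_def)
    have "(cmod (of_real (r y - 1)))\<^sup>2 \<le> 1" for y
    proof -
      have "0 \<le> r y" "r y \<le> 2" using card_nonzero_sqrts_le[of y] by (auto simp: r_def)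
      hence "\<bar>r y - 1\<bar> \<le> 1" by linarith
      thus ?thesis by (simp add: abs_square_le_1 del: of_real_diff)
    qed
    hence "(\<Sum>y\<in>UNIV - {0}. (cmod (of_real (r y - 1)))\<^sup>2) \<le> (\<Sum>y\<in>(UNIV - {0} :: 'a set). 1)"
      by (intro sum_mono)
    thus "(\<Sum>y\<in>UNIV - {0}. (cmod (of_real (r y - 1)))\<^sup>2) \<le> 1 * real (q ^ n - 1)"
      using card_nonzero by simp
  qed
  moreover have "(\<Sum>y\<in>trace_zero. r y) = real (card square_trace_zero)"
    using sum_trace_zero_nonzero_sqrts[of "\<lambda>_. 1 :: real"] by (simp add: r_def)
  hence "(\<Sum>y\<in>trace_zero. r y - 1) = real (card square_trace_zero) - (real q ^ (n - 1) - 1)"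
    using card_trace_zero by (simp add: sum_subtractf)
  moreover have "cmod (\<Sum>y\<in>trace_zero. of_real (r y - 1)) = \<bar>\<Sum>y\<in>trace_zero. r y - 1\<bar>"
    by (metis norm_of_real of_real_sum)
  ultimately show ?thesis by simp
qed

end

subsection \<open>Power residues and free elements\<close>

text \<open>For \<open>x = g ^ k\<close> both sides say that \<open>p\<close> divides
  \<open>k\<close>.\<close>

lemma nonzero_nth_power_iff:
  fixes x :: "'a::finite_field"
  assumes "p dvd CARD('a) - 1" "x \<noteq> 0"
  shows "(\<exists>z. z \<noteq> 0 \<and> x = z ^ p) \<longleftrightarrow> x ^ ((CARD('a) - 1) div p) = 1"
proof -
  obtain g :: 'a where g: "g \<noteq> 0" "\<And>x. x \<noteq> 0 \<Longrightarrow> \<exists>k. x = g ^ k"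
    "\<And>k. g ^ k = 1 \<longleftrightarrow> CARD('a) - 1 dvd k"
    using finite_field_has_generator by metis
  obtain e where e: "CARD('a) - 1 = p * e" using assms by auto
  have "card {0, 1 :: 'a} \<le> CARD('a)" by (rule card_mono) auto
  hence pos: "p > 0" "e > 0" using e by (auto intro: Nat.gr0I)
  show ?thesis
  proof
    assume "\<exists>z. z \<noteq> 0 \<and> x = z ^ p"
    then obtain z k where "x = z ^ p" "z = g ^ k" using g(2) by blast
    thus "x ^ ((CARD('a) - 1) div p) = 1"
      using e pos g(3)[of "k * p * e"] by (simp flip: power_mult)
  next
    assume *: "x ^ ((CARD('a) - 1) div p) = 1"
    obtain k where k: "x = g ^ k" using g(2) assms by blast
    have "p * e dvd k * e" using * k e pos g(3)[of "k * e"] by (simp flip: power_mult)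
    hence "p dvd k" using pos by simp
    then obtain j where "k = j * p" by (metis dvdE mult.commute)
    thus "\<exists>z. z \<noteq> 0 \<and> x = z ^ p"
      using g(1) k by (intro exI[of _ "g ^ j"]) (simp add: power_mult)
  qed
qed

lemma free_elem_iff_prime:
  assumes "m > 0"
  shows "free_elem m x \<longleftrightarrow> x \<noteq> 0 \<and> (\<forall>p\<in>prime_factors m. \<not> (\<exists>z. z \<noteq> 0 \<and> x = z ^ p))"
proof (cases "x = 0")
  case False
  have "d = 1" if primes: "\<forall>p\<in>prime_factors m. \<not> (\<exists>z. z \<noteq> 0 \<and> x = z ^ p)"
    and d: "d dvd m" "z \<noteq> 0" "x = z ^ d" for d z
  proof (rule ccontr)
    assume "d \<noteq> 1"
    \<comment> \<open>A \<open>d\<close>-th power is a \<open>p\<close>-th power for every prime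
      \<open>p\<close> dividing \<open>d\<close>, so testing primes is enough.\<close>
    then obtain p e where p: "prime p" "d = p * e" using prime_factor_nat by (metis dvdE)
    hence "p \<in> prime_factors m" using d assms by (auto simp: in_prime_factors_iff)
    moreover have "z ^ e \<noteq> 0 \<and> x = (z ^ e) ^ p"
      using d p by (simp add: mult.commute flip: power_mult)
    ultimately show False using primes by blast
  qed
  moreover have "\<not> (\<exists>z. z \<noteq> 0 \<and> x = z ^ p)" if "free_elem m x" "p \<in> prime_factors m" for p
  proof -
    have "p dvd m" "p \<noteq> 1" using that by (auto simp: in_prime_factors_iff)
    thus ?thesis using that by (auto simp: free_elem_def)
  qed
  ultimately show ?thesis using False by (auto simp: free_elem_def)
qed (simp add: free_elem_def)

lemma sum_powers_root_of_unity:
  fixes w :: complex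
  assumes "w ^ p = 1" "p > 0"
  shows "(\<Sum>j=1..<p. w ^ j) = (if w = 1 then of_nat p - 1 else - 1)"
proof -
  have "(\<Sum>j<p. w ^ j) = (if w = 1 then of_nat p else 0)"
    using assms by (simp add: geometric_sum)
  moreover have "{..<p} = insert 0 {1..<p}" using assms by auto
  hence "(\<Sum>j<p. w ^ j) = 1 + (\<Sum>j=1..<p. w ^ j)" by simp
  ultimately have "(\<Sum>j=1..<p. w ^ j) = (if w = 1 then of_nat p else 0) - 1"
    by (metis add_diff_cancel_left')
  thus ?thesis by simp
qed

text \<open>In other words, a sum of fractions \<open>J p / p\<close> in lowest terms over distinct
  primes is not an integer.\<close>

lemma not_dvd_sum_prime_fractions:
  fixes N :: nat
  assumes "finite D" "D \<noteq> {}" "N > 0" and D: "\<And>p. p \<in> D \<Longrightarrow> prime p \<and> p dvd N"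
    and J: "\<And>p. p \<in> D \<Longrightarrow> 1 \<le> J p \<and> J p < p"
  shows "\<not> N dvd (\<Sum>p\<in>D. J p * (N div p))"
proof
  assume dvd: "N dvd (\<Sum>p\<in>D. J p * (N div p))"
  obtain r where r: "r \<in> D" using assms by blast
  \<comment> \<open>Multiplying by all primes except \<open>r\<close> makes every other term a
    multiple of \<open>N\<close>; the remaining one would force \<open>r\<close> to divide
    \<open>M * J r\<close>.\<close>
  define M where "M = \<Prod>(D - {r})"
  have "N dvd M * (\<Sum>p\<in>D. J p * (N div p))" using dvd by (rule dvd_mult)
  also have "M * (\<Sum>p\<in>D. J p * (N div p)) =
      M * (J r * (N div r)) + (\<Sum>p\<in>D - {r}. M * (J p * (N div p)))"
    using assms(1) r by (simp add: sum.remove algebra_simps sum_distrib_left)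
  finally have "N dvd M * (J r * (N div r))"
  proof (subst (asm) dvd_add_left_iff)
    show "N dvd (\<Sum>p\<in>D - {r}. M * (J p * (N div p)))"
    proof (rule dvd_sum)
      fix p assume p: "p \<in> D - {r}"
      hence "p dvd M" unfolding M_def using assms(1) by (intro dvd_prodI) auto
      then obtain M' where M': "M = p * M'" ..
      have "M * (J p * (N div p)) = p * (N div p) * (M' * J p)"
        unfolding M' by (simp only: mult_ac)
      also have "p * (N div p) = N" using D p by simp
      finally show "N dvd M * (J p * (N div p))" by (simp only: dvd_triv_left)
    qed
  qed
  moreover have N: "N = r * (N div r)" using D r by simp
  ultimately have "r * (N div r) dvd (M * J r) * (N div r)" by (metis mult.assoc)
  moreover have "N div r > 0" using N assms(3) by (metis gr0I mult_0_right less_irrefl)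
  ultimately have "r dvd M * J r" by simp
  moreover have "\<not> r dvd J r" using J[OF r] by (auto dest: dvd_imp_le)
  moreover have "\<not> r dvd M"
  proof
    assume "r dvd M"
    then obtain p where "p \<in> D - {r}" "r dvd p"
      unfolding M_def using prime_dvd_prod_iff[of "D - {r}" r "\<lambda>x. x"] D[OF r] assms(1) by auto
    thus False using D[OF r] D[of p] primes_dvd_imp_eq by blast
  qed
  ultimately show False using D[OF r] prime_dvd_mult_iff by blast
qed

text \<open>Products over different sets of prime factors are different squarefree divisors, by
  unique factorization.\<close>

lemma two_power_card_prime_factors_le:
  assumes "m > 0"
  shows "2 ^ card (prime_factors m) \<le> num_squarefree_divisors m"
proof -
  have pf: "prime_factorization (\<Prod>D) = mset_set D" if "D \<subseteq> prime_factors m" for D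
    using that finite_subset[OF that] prime_factorization_prod_mset_primes[of "mset_set D"]
    by (auto simp: prod_unfold_prod_mset)
  have "inj_on Prod (Pow (prime_factors m))"
  proof (rule inj_onI)
    fix D E assume *: "D \<in> Pow (prime_factors m)" "E \<in> Pow (prime_factors m)" "\<Prod>D = \<Prod>E"
    hence "mset_set D = mset_set E" by (metis PowD pf)
    moreover have "finite D" "finite E" using * finite_subset[of _ "prime_factors m"] by auto
    ultimately show "D = E" by (metis finite_set_mset_mset_set)
  qed
  moreover have "Prod ` Pow (prime_factors m) \<subseteq> {d. d dvd m \<and> squarefree d}"
  proof clarify
    fix D assume D: "D \<subseteq> prime_factors m"
    hence fin: "finite D" using finite_subset by blast
    have "prime p" if "p \<in> D" for p using D that by auto
    hence "squarefree (\<Prod>D)"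
      by (intro squarefree_prod_coprime) (auto intro: primes_coprime squarefree_prime)
    moreover have "\<Prod>D dvd m"
    proof -
      have "mset_set D \<subseteq># prime_factorization m"
        unfolding subseteq_mset_def using D fin by (auto simp: count_mset_set')
      moreover have "\<Prod>D \<noteq> 0" using D fin by auto
      ultimately show ?thesis
        using pf[OF D] assms by (simp flip: prime_factorization_subset_iff_dvd)
    qed
    ultimately show "\<Prod>D dvd m \<and> squarefree (\<Prod>D)" by blast
  qed
  moreover have "finite {d. d dvd m \<and> squarefree d}"
    using assms by (intro finite_subset[OF _ finite_divisors_nat]) auto
  ultimately have "card (Pow (prime_factors m)) \<le> card {d. d dvd m \<and> squarefree d}"
    by (rule card_inj_on_le)
  thus ?thesis by (simp add: card_Pow num_squarefree_divisors_def)
qed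

section \<open>Character expansion of the indicator of free elements\<close>

context finite_extension
begin

text \<open>
  With \<open>\<chi>\<close> a faithful character, the sum is over the \<open>p - 1\<close> characters of order \<open>p\<close>, so
  the weight is \<open>- 1\<close> on \<open>p\<close>-th powers and \<open>1 / (p - 1)\<close> elsewhere.
\<close>

definition power_weight :: "('a \<Rightarrow> complex) \<Rightarrow> nat \<Rightarrow> 'a \<Rightarrow> complex" where
  "power_weight \<chi> p x = - (1 / of_nat (p - 1)) * (\<Sum>j=1..<p. \<chi> x ^ (j * ((q ^ n - 1) div p)))"

text \<open>This is \<open>(q - 1) q ^ (n / 2 - 1)\<close>, half the bound for a nontrivial
  character sum.\<close>

definition error_scale :: real where
  "error_scale = (real q - 1) * sqrt (real q ^ (n - 2))"

lemma error_scale_square: "error_scale\<^sup>2 = real q ^ (n - 2) * (real q - 1)\<^sup>2"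
  by (simp add: error_scale_def power_mult_distrib)

lemma error_scale_nonneg: "error_scale \<ge> 0"
  using q_gt_1 by (simp add: error_scale_def)

context
  fixes \<chi> :: "'a \<Rightarrow> complex"
  assumes mult: "\<And>x y. x \<noteq> 0 \<Longrightarrow> y \<noteq> 0 \<Longrightarrow> \<chi> (x * y) = \<chi> x * \<chi> y"
    and norm: "\<And>x. x \<noteq> 0 \<Longrightarrow> cmod (\<chi> x) = 1"
    and faithful: "\<And>x. x \<noteq> 0 \<Longrightarrow> \<chi> x = 1 \<longleftrightarrow> x = 1"
begin

lemma character_power: "x \<noteq> 0 \<Longrightarrow> \<chi> x ^ k = \<chi> (x ^ k)"
  by (induction k) (auto simp: mult faithful)

text \<open>The number \<open>w\<close> is a \<open>p\<close>-th root of unity, equal to 1 exactly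
  at \<open>p\<close>-th powers. There the weight \<open>- 1\<close> gives 0; elsewhere
  \<open>(1 - 1 / p) * (1 + 1 / (p - 1)) = 1\<close>.\<close>

lemma not_power_indicator:
  assumes "prime p" "p dvd q ^ n - 1" "x \<noteq> 0"
  shows "of_bool (\<not> (\<exists>z. z \<noteq> 0 \<and> x = z ^ p)) =
    (1 - 1 / of_nat p) * (power_weight \<chi> p x + 1)"
proof -
  define w where "w = \<chi> x ^ ((q ^ n - 1) div p)"
  have p: "p > 1" using assms prime_gt_1_nat by blast
  have "x ^ (q ^ n) = x" using finite_field_power_card_eq_same[of x] card_UNIV by simp
  moreover have "q ^ n = Suc (q ^ n - 1)" using card_nonzero_pos by simp
  ultimately have "x * x ^ (q ^ n - 1) = x" by (metis power_Suc)
  hence "x ^ (q ^ n - 1) = 1" using assms by simp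
  moreover have "w ^ p = \<chi> x ^ (q ^ n - 1)"
    using assms by (simp add: w_def flip: power_mult)
  ultimately have wp: "w ^ p = 1"
    using assms faithful[of 1] character_power[of x "q ^ n - 1"] by simp
  have w1: "w = 1 \<longleftrightarrow> (\<exists>z. z \<noteq> 0 \<and> x = z ^ p)"
    using nonzero_nth_power_iff[of p x] faithful[of "x ^ ((q ^ n - 1) div p)"] assms card_UNIV
    by (simp add: w_def character_power[OF assms(3)])
  have "power_weight \<chi> p x = - (1 / of_nat (p - 1)) * (\<Sum>j=1..<p. w ^ j)"
    by (simp add: power_weight_def w_def mult.commute flip: power_mult)
  also have "(\<Sum>j=1..<p. w ^ j) = (if w = 1 then of_nat p - 1 else - 1)"
    using wp p by (intro sum_powers_root_of_unity) auto
  finally have pw: "power_weight \<chi> p x =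
      - (1 / (of_nat p - 1)) * (if w = 1 then of_nat p - 1 else - 1)"
    using p by (simp add: of_nat_diff)
  have "of_nat p \<noteq> (1 :: complex)" "of_nat p \<noteq> (0 :: complex)"
    using p of_nat_eq_1_iff[of p, where ?'a = complex] by auto
  thus ?thesis unfolding w1[symmetric] pw by (auto simp: field_simps)
qed

text \<open>Expanding the product picks an exponent \<open>J p\<close> for each prime and yields the
  characters \<open>\<chi> ^ e J\<close>. They are nontrivial, and their coefficients have total
  modulus 1, so the bound for one character survives.\<close>

lemma norm_sum_prod_power_weight_le:
  assumes "finite D" "D \<noteq> {}" and D: "\<And>p. p \<in> D \<Longrightarrow> prime p \<and> p dvd q ^ n - 1"
  shows "cmod (\<Sum>x\<in>square_trace_zero. \<Prod>p\<in>D. power_weight \<chi> p x) \<le> 2 * error_scale"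
proof -
  define N where "N = q ^ n - 1"
  define c :: complex where "c = (\<Prod>p\<in>D. - (1 / of_nat (p - 1)))"
  define \<J> where "\<J> = PiE D (\<lambda>p. {1..<p})"
  define e where "e J = (\<Sum>p\<in>D. J p * (N div p))" for J
  have expand: "(\<Prod>p\<in>D. power_weight \<chi> p x) = c * (\<Sum>J\<in>\<J>. \<chi> x ^ e J)" for x
  proof -
    have "(\<Prod>p\<in>D. power_weight \<chi> p x) = c * (\<Prod>p\<in>D. \<Sum>j=1..<p. \<chi> x ^ (j * (N div p)))"
      unfolding power_weight_def c_def N_def by (rule prod.distrib)
    also have "(\<Prod>p\<in>D. \<Sum>j=1..<p. \<chi> x ^ (j * (N div p))) =
        (\<Sum>J\<in>\<J>. \<Prod>p\<in>D. \<chi> x ^ (J p * (N div p)))"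
      unfolding \<J>_def using assms(1) by (intro prod_sum_PiE) auto
    finally show ?thesis by (simp add: e_def power_sum)
  qed
  have bound: "cmod (\<Sum>x\<in>square_trace_zero. \<chi> x ^ e J) \<le> 2 * error_scale" if J: "J \<in> \<J>" for J
  proof -
    have "\<not> N dvd e J"
      unfolding e_def using assms J card_nonzero_pos
      by (intro not_dvd_sum_prime_fractions) (auto simp: N_def \<J>_def PiE_iff)
    \<comment> \<open>A generator witnesses nontriviality: \<open>g ^ e J = 1\<close> would make
      \<open>N\<close> divide \<open>e J\<close>.\<close>
    obtain g :: 'a where g: "g \<noteq> 0" "\<And>x. x \<noteq> 0 \<Longrightarrow> \<exists>k. x = g ^ k"
      "\<And>k. g ^ k = 1 \<longleftrightarrow> CARD('a) - 1 dvd k"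
      using finite_field_has_generator by metis
    have "g ^ e J \<noteq> 1" using \<open>\<not> N dvd e J\<close> g(3)[of "e J"] card_UNIV by (simp add: N_def)
    hence "\<chi> g ^ e J \<noteq> 1"
      using faithful[of "g ^ e J"] g(1) by (simp add: character_power[OF g(1)])
    hence "(cmod (\<Sum>x\<in>square_trace_zero. \<chi> x ^ e J))\<^sup>2 \<le> (2 * error_scale)\<^sup>2"
      using square_trace_zero_character_sum_le[of "\<lambda>x. \<chi> x ^ e J" g] g(1) mult norm
      by (simp add: power_mult_distrib norm_power error_scale_square)
    thus ?thesis by (rule power2_le_imp_le) (use error_scale_nonneg in simp)
  qed
  have "(\<Sum>x\<in>square_trace_zero. \<Prod>p\<in>D. power_weight \<chi> p x) =
      c * (\<Sum>J\<in>\<J>. \<Sum>x\<in>square_trace_zero. \<chi> x ^ e J)"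
    unfolding expand sum_distrib_left[symmetric] by (subst sum.swap) simp
  hence "cmod (\<Sum>x\<in>square_trace_zero. \<Prod>p\<in>D. power_weight \<chi> p x) =
      cmod c * cmod (\<Sum>J\<in>\<J>. \<Sum>x\<in>square_trace_zero. \<chi> x ^ e J)"
    by (simp add: norm_mult)
  also have "\<dots> \<le> cmod c * (\<Sum>J\<in>\<J>. 2 * error_scale)"
    by (intro mult_left_mono sum_norm_le bound) auto
  also have "\<dots> = (cmod c * real (card \<J>)) * (2 * error_scale)" by simp
  also have "cmod c * real (card \<J>) = (\<Prod>p\<in>D. 1 / real (p - 1) * real (p - 1))"
    unfolding prod.distrib c_def \<J>_def using assms(1)
    by (simp add: card_PiE norm_divide flip: prod_norm)
  also have "\<dots> = 1"
  proof (rule prod.neutral, rule ballI)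
    fix p assume "p \<in> D"
    hence "p > 1" using D prime_gt_1_nat by blast
    thus "1 / real (p - 1) * real (p - 1) = 1" by simp
  qed
  finally show ?thesis by simp
qed

text \<open>A product of the indicators for the single primes; the constants combine to
  \<open>theta m\<close> by Euler's product for the totient.\<close>

lemma free_elem_indicator:
  assumes "m > 0" "m dvd q ^ n - 1" "x \<noteq> 0"
  shows "of_bool (free_elem m x) =
    complex_of_real (theta m) * (\<Prod>p\<in>prime_factors m. power_weight \<chi> p x + 1)"
proof -
  have "of_bool (free_elem m x) =
      (\<Prod>p\<in>prime_factors m. of_bool (\<not> (\<exists>z. z \<noteq> 0 \<and> x = z ^ p)) :: complex)"
    using assms by (simp add: free_elem_iff_prime)
  also have "\<dots> = (\<Prod>p\<in>prime_factors m. (1 - 1 / of_nat p) * (power_weight \<chi> p x + 1))"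
    using assms by (intro prod.cong refl not_power_indicator)
      (auto simp: in_prime_factors_iff intro: dvd_trans)
  also have "\<dots> = (\<Prod>p\<in>prime_factors m. 1 - 1 / of_nat p) *
      (\<Prod>p\<in>prime_factors m. power_weight \<chi> p x + 1)"
    by (rule prod.distrib)
  also have "(\<Prod>p\<in>prime_factors m. 1 - 1 / of_nat p) = complex_of_real (theta m)"
    using assms by (simp add: theta_def totient_formula2)
  finally show ?thesis .
qed

text \<open>The product is expanded over sets of primes: the empty set gives the main term, each of
  the others an error of at most \<open>2 * error_scale\<close>.\<close>

lemma card_free_square_trace_zero_approx:
  assumes "m > 0" "m dvd q ^ n - 1"
  shows "\<bar>real (num_free_trace_sq q n (0::'a) m) - theta m * real (card square_trace_zero)\<bar>
    \<le> theta m * ((2 ^ card (prime_factors m) - 1) * (2 * error_scale))"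
proof -
  define P where "P = prime_factors m"
  define S where "S D = (\<Sum>x\<in>square_trace_zero. \<Prod>p\<in>D. power_weight \<chi> p x)" for D
  have P: "finite P" by (simp add: P_def)
  have "num_free_trace_sq q n (0::'a) m = card {x \<in> square_trace_zero. free_elem m x}"
    unfolding num_free_trace_sq_def square_trace_zero_def
    by (rule arg_cong[of _ _ card]) (auto simp: free_elem_def)
  hence "complex_of_nat (num_free_trace_sq q n (0::'a) m) =
      (\<Sum>x\<in>square_trace_zero. of_bool (free_elem m x))"
    by (simp add: sum.If_cases of_bool_def Int_def)
  also have "\<dots> = (\<Sum>x\<in>square_trace_zero. of_real (theta m) * (\<Prod>p\<in>P. power_weight \<chi> p x + 1))"
    unfolding P_def
    by (intro sum.cong refl free_elem_indicator assms) (auto simp: square_trace_zero_def)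
  also have "\<dots> = of_real (theta m) * (\<Sum>x\<in>square_trace_zero. \<Sum>D\<in>Pow P. \<Prod>p\<in>D. power_weight \<chi> p x)"
    by (simp add: prod_add[OF P] flip: sum_distrib_left)
  also have "(\<Sum>x\<in>square_trace_zero. \<Sum>D\<in>Pow P. \<Prod>p\<in>D. power_weight \<chi> p x) = (\<Sum>D\<in>Pow P. S D)"
    unfolding S_def by (rule sum.swap)
  also have "\<dots> = S {} + (\<Sum>D\<in>Pow P - {{}}. S D)"
    using P by (intro sum.remove) auto
  also have "S {} = of_nat (card square_trace_zero)" by (simp add: S_def)
  finally have "complex_of_real (real (num_free_trace_sq q n (0::'a) m) - theta m * real (card square_trace_zero)) =
      of_real (theta m) * (\<Sum>D\<in>Pow P - {{}}. S D)"
    by (simp add: algebra_simps)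
  hence "\<bar>real (num_free_trace_sq q n (0::'a) m) - theta m * real (card square_trace_zero)\<bar> =
      \<bar>theta m\<bar> * cmod (\<Sum>D\<in>Pow P - {{}}. S D)"
    by (metis norm_mult norm_of_real)
  also have "\<bar>theta m\<bar> = theta m" by (simp add: theta_def)
  also have "theta m * cmod (\<Sum>D\<in>Pow P - {{}}. S D) \<le> theta m * (\<Sum>D\<in>Pow P - {{}}. 2 * error_scale)"
  proof (intro mult_left_mono sum_norm_le)
    fix D assume "D \<in> Pow P - {{}}"
    hence "D \<subseteq> P" "D \<noteq> {}" "finite D" using P finite_subset by auto
    moreover have "prime p \<and> p dvd q ^ n - 1" if "p \<in> D" for p
      using that \<open>D \<subseteq> P\<close> assms by (auto simp: P_def in_prime_factors_iff intro: dvd_trans)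
    ultimately show "cmod (S D) \<le> 2 * error_scale"
      unfolding S_def by (intro norm_sum_prod_power_weight_le)
  qed (simp add: theta_def)
  also have "(\<Sum>D\<in>Pow P - {{}}. 2 * error_scale) = (2 ^ card P - 1) * (2 * error_scale)"
    using P by (simp add: card_Diff_singleton card_Pow of_nat_diff)
  finally show ?thesis by (simp add: P_def)
qed

end

text \<open>The size of \<open>square_trace_zero\<close> falls short of \<open>q ^ (n - 1)\<close>
  by at most \<open>2 * error_scale\<close>. This fills the place of the empty set of primes,
  turning \<open>W - 1\<close> error terms into \<open>W\<close>.\<close>

lemma num_free_trace_sq_ge:
  assumes "m dvd q ^ n - 1" "q \<ge> 3"
  shows "real (num_free_trace_sq q n (0::'a) m) \<ge>
    theta m * (real q ^ (n - 1) - 2 * real (num_squarefree_divisors m) * error_scale)"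
proof -
  have m: "m > 0" using assms card_nonzero_pos by (auto intro: Nat.gr0I)
  obtain \<chi> :: "'a \<Rightarrow> complex" where \<chi>: 
    "\<And>x y. x \<noteq> 0 \<Longrightarrow> y \<noteq> 0 \<Longrightarrow> \<chi> (x * y) = \<chi> x * \<chi> y"
    "\<And>x. x \<noteq> 0 \<Longrightarrow> cmod (\<chi> x) = 1" "\<And>x. x \<noteq> 0 \<Longrightarrow> \<chi> x = 1 \<longleftrightarrow> x = 1"
    using finite_field_has_faithful_character by metis
  define X where "X = real (card square_trace_zero)"
  define W where "W = real (num_squarefree_divisors m)"
  have "2 ^ card (prime_factors m) \<le> W"
    using two_power_card_prime_factors_le[OF m] unfolding W_def
    by (metis of_nat_le_iff of_nat_numeral of_nat_power)
  have "1 \<le> sqrt (real q ^ (n - 2))" using q_gt_1 by (simp add: one_le_power)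
  hence es2: "2 \<le> error_scale"
    unfolding error_scale_def using assms(2) mult_mono[of 2 "real q - 1" 1 "sqrt (real q ^ (n - 2))"]
    by simp
  have "(X - (real q ^ (n - 1) - 1))\<^sup>2 \<le> 2 * error_scale\<^sup>2"
    using card_square_trace_zero_approx unfolding X_def error_scale_square .
  \<comment> \<open>A rational bound for the square root of 2. As
    \<open>error_scale \<ge> 2\<close>, the spare half of it absorbs the \<open>- 1\<close> from
    excluding zero.\<close>
  also have "\<dots> \<le> (3 / 2 * error_scale)\<^sup>2" by (simp add: power_mult_distrib power2_eq_square)
  finally have "\<bar>X - (real q ^ (n - 1) - 1)\<bar> \<le> 3 / 2 * error_scale"
    using error_scale_nonneg by (metis abs_le_square_iff abs_of_nonneg mult_nonneg_nonneg zero_le_divide_iff zero_le_numeral)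
  hence X: "X \<ge> real q ^ (n - 1) - 2 * error_scale" using es2 by linarith
  have "theta m * (real q ^ (n - 1) - 2 * W * error_scale) \<le>
      theta m * (X - (2 ^ card (prime_factors m) - 1) * (2 * error_scale))"
  proof (rule mult_left_mono)
    have "(2 ^ card (prime_factors m) - 1) * (2 * error_scale) \<le> (W - 1) * (2 * error_scale)"
      using \<open>2 ^ card (prime_factors m) \<le> W\<close> error_scale_nonneg by (intro mult_right_mono) auto
    thus "real q ^ (n - 1) - 2 * W * error_scale \<le>
        X - (2 ^ card (prime_factors m) - 1) * (2 * error_scale)"
      using X by (simp add: algebra_simps)
  qed (simp add: theta_def)
  also have "\<dots> \<le> real (num_free_trace_sq q n (0::'a) m)"
    using card_free_square_trace_zero_approx[OF \<chi> m assms(1)] unfolding X_def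
    by (simp add: algebra_simps abs_le_iff)
  finally show ?thesis unfolding W_def .
qed

text \<open>
  Multiplying by elements of the base field preserves the trace condition, and the right
  multiplier turns a \<open>Q\<close>-free element into a primitive one.
\<close>

lemma num_free_trace_sq_full_pos:
  assumes Q: "Q * (q - 1) = q ^ n - 1" and pos: "num_free_trace_sq q n (0::'a) Q > 0"
  shows "num_free_trace_sq q n (0::'a) (q ^ n - 1) > 0"
proof -
  define N where "N = q ^ n - 1"
  have N: "N > 0" using card_nonzero_pos by (simp add: N_def)
  have "Q > 0" using Q N by (auto simp: N_def intro: Nat.gr0I)
  have "Q dvd N" unfolding N_def Q[symmetric] by (rule dvd_triv_left)
  obtain \<xi> :: 'a where \<xi>: "free_elem Q \<xi>" "tr (\<xi>\<^sup>2) = 0"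
    using pos by (auto simp: num_free_trace_sq_def card_gt_0_iff)
  obtain g :: 'a where g: "g \<noteq> 0" "\<And>x. x \<noteq> 0 \<Longrightarrow> \<exists>k. x = g ^ k"
    "\<And>k. g ^ k = 1 \<longleftrightarrow> CARD('a) - 1 dvd k"
    using finite_field_has_generator by metis
  have power_iff: "(\<exists>z. z \<noteq> 0 \<and> g ^ k = z ^ p) \<longleftrightarrow> p dvd k" if p: "p dvd N" for p k
  proof -
    obtain e where e: "N = p * e" using p ..
    have "(\<exists>z. z \<noteq> 0 \<and> g ^ k = z ^ p) \<longleftrightarrow> (g ^ k) ^ (N div p) = 1"
      using nonzero_nth_power_iff[of p "g ^ k"] g(1) p card_UNIV by (simp add: N_def)
    also have "\<dots> \<longleftrightarrow> p * e dvd k * e"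
      using g(3)[of "k * (N div p)"] card_UNIV e N by (simp add: N_def power_mult)
    finally show ?thesis using e N by simp
  qed
  have "\<xi> \<noteq> 0" using \<xi>(1) by (simp add: free_elem_def)
  then obtain k where k: "\<xi> = g ^ k" using g(2) by blast
  have coprime: "\<not> p dvd k" if "prime p" "p dvd Q" for p
  proof -
    have "p \<in> prime_factors Q" using that \<open>Q > 0\<close> by (simp add: in_prime_factors_iff)
    hence "\<not> (\<exists>z. z \<noteq> 0 \<and> g ^ k = z ^ p)"
      using \<xi>(1) k unfolding free_elem_iff_prime[OF \<open>Q > 0\<close>] by blast
    moreover have "p dvd N" using that(2) \<open>Q dvd N\<close> by (rule dvd_trans)
    ultimately show ?thesis using power_iff by blast
  qed
  \<comment> \<open>With this \<open>j\<close>, each prime factor of \<open>N\<close> divides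
    exactly one of \<open>Q * j\<close> and \<open>k\<close>: a prime dividing \<open>k\<close>
    divides neither \<open>Q\<close>, by \<open>Q\<close>-freeness, nor \<open>j\<close>. So the
    exponent \<open>Q * j + k\<close> of \<open>\<zeta>\<close> is prime to
    \<open>N\<close>.\<close>
  define j where "j = \<Prod>{p \<in> prime_factors N. \<not> p dvd k}"
  define \<zeta> where "\<zeta> = g ^ (Q * j) * \<xi>"
  have "free_elem N \<zeta>"
    unfolding free_elem_iff_prime[OF N]
  proof (intro conjI ballI)
    show "\<zeta> \<noteq> 0" using g(1) \<open>\<xi> \<noteq> 0\<close> by (simp add: \<zeta>_def)
    fix p assume p: "p \<in> prime_factors N"
    hence pN: "prime p" "p dvd N" by (auto simp: in_prime_factors_iff)
    have "\<not> p dvd Q * j + k"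
    proof (cases "p dvd k")
      case True
      have "\<not> p dvd j"
      proof
        assume "p dvd j"
        then obtain r where "r \<in> prime_factors N" "\<not> r dvd k" "p dvd r"
          unfolding j_def using prime_dvd_prod_iff[of "{p \<in> prime_factors N. \<not> p dvd k}" p "\<lambda>x. x"] pN
          by auto
        thus False using True pN primes_dvd_imp_eq[of p r] by auto
      qed
      hence "\<not> p dvd Q * j" using True coprime[of p] pN prime_dvd_mult_iff by blast
      thus ?thesis using True by (simp add: dvd_add_left_iff)
    next
      case False
      hence "p dvd j" unfolding j_def using p by (intro dvd_prodI) auto
      thus ?thesis using False by (simp add: dvd_add_right_iff)
    qed
    thus "\<not> (\<exists>z. z \<noteq> 0 \<and> \<zeta> = z ^ p)"
      using power_iff[OF pN(2), of "Q * j + k"] by (simp add: \<zeta>_def k power_add)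
  qed
  moreover have "tr (\<zeta>\<^sup>2) = 0"
  proof -
    \<comment> \<open>Since \<open>Q * (q - 1)\<close> is the order of \<open>g\<close>, the power
      \<open>g ^ Q\<close> lies in the subfield, and the square of the multiplier can be taken out
      of the trace.\<close>
    have "(g ^ Q) ^ (q - 1) = 1" using Q g(3)[of N] card_UNIV by (simp add: N_def flip: power_mult)
    hence "(g ^ Q) ^ Suc (q - 1) = g ^ Q" by simp
    hence "g ^ Q \<in> base" using q_gt_1 by (simp add: base_def)
    hence "g ^ (Q * i) \<in> base" for i
      by (induction i) (auto simp: one_in_base power_add intro: mult_in_base)
    hence "(g ^ (Q * j))\<^sup>2 \<in> base" by (simp add: power2_eq_square mult_in_base)
    thus ?thesis using \<xi>(2) by (simp add: \<zeta>_def power_mult_distrib tr_base_mult)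
  qed
  ultimately show ?thesis
    by (auto simp: num_free_trace_sq_def card_gt_0_iff N_def)
qed

end

theorem theorem5p8:
  fixes q n Q :: nat
  assumes "primepow q" and "odd q" and "n \<ge> 3"
    and "even ((q ^ n - 1) div 2)"
    and "CARD('a::finite_field) = q ^ n"
    and "Q = (q ^ n - 1) div (q - 1)"
  shows "(\<forall>m. m dvd Q \<longrightarrow>
            real (num_free_trace_sq q n (0::'a) m) \<ge>
              theta m * real q powr (real n / 2 - 1) *
                (real q powr (real n / 2) - 2 * real (num_squarefree_divisors m) * (real q - 1)))
       \<and> (real q powr (real n / 2) > 2 * real (num_squarefree_divisors Q) * (real q - 1) \<longrightarrow>
            num_free_trace_sq q n (0::'a) (q ^ n - 1) > 0)"
proof -
  interpret finite_extension q n "TYPE('a)"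
    by unfold_locales (use assms in auto)
  have q: "q \<ge> 3" using q_gt_1 \<open>odd q\<close> by (cases "q = 2") auto
  \<comment> \<open>From \<open>q\<close> being 1 modulo \<open>q - 1\<close>; thus the division
    defining \<open>Q\<close> is exact.\<close>
  have "(q - 1) dvd q ^ n - 1"
    using q_gt_1 cong_to_1_nat[of "q ^ n" "q - 1"] cong_pow[of q 1 "q - 1" n]
    by (simp add: cong_def mod_if le_mod_geq)
  hence Q: "Q * (q - 1) = q ^ n - 1" using assms(6) by simp
  have es: "error_scale = (real q - 1) * real q powr (real n / 2 - 1)"
  proof -
    have "sqrt (real q ^ (n - 2)) = (real q ^ (n - 2)) powr (1 / 2)"
      by (simp add: powr_half_sqrt)
    also have "\<dots> = real q powr (real (n - 2) * (1 / 2))"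
      using q by (simp add: powr_powr flip: powr_realpow)
    also have "real (n - 2) * (1 / 2) = real n / 2 - 1" using assms(3) by (simp add: of_nat_diff field_simps)
    finally show ?thesis by (simp add: error_scale_def)
  qed
  \<comment> \<open>This lets \<open>q powr (n / 2 - 1)\<close> be taken out of the main term as
    well as the error.\<close>
  have qn: "real q powr (real n / 2 - 1) * real q powr (real n / 2) = real q ^ (n - 1)"
    using q assms(3) by (simp add: of_nat_diff flip: powr_add powr_realpow)
  have main: "theta m * real q powr (real n / 2 - 1) *
      (real q powr (real n / 2) - 2 * real (num_squarefree_divisors m) * (real q - 1))
      \<le> real (num_free_trace_sq q n (0::'a) m)" if "m dvd Q" for m
  proof -
    have "m dvd q ^ n - 1" using that Q by (metis dvd_mult2)
    from num_free_trace_sq_ge[OF this q] show ?thesis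
      unfolding es qn[symmetric] by (simp add: algebra_simps)
  qed
  moreover have "num_free_trace_sq q n (0::'a) (q ^ n - 1) > 0"
    if "real q powr (real n / 2) > 2 * real (num_squarefree_divisors Q) * (real q - 1)"
  proof (rule num_free_trace_sq_full_pos[OF Q])
    \<comment> \<open>Positivity of \<open>Q\<close> makes \<open>theta Q\<close> positive, so under
      the hypothesis the lower bound for \<open>m = Q\<close> is strictly positive.\<close>
    have "Q > 0" using Q card_nonzero_pos by (auto intro: Nat.gr0I)
    hence "theta Q * real q powr (real n / 2 - 1) > 0" using q by (simp add: theta_def)
    hence "0 < theta Q * real q powr (real n / 2 - 1) *
      (real q powr (real n / 2) - 2 * real (num_squarefree_divisors Q) * (real q - 1))"
      using that by simp
    also have "\<dots> \<le> real (num_free_trace_sq q n (0::'a) Q)" by (rule main) simp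
    finally show "num_free_trace_sq q n (0::'a) Q > 0" by simp
  qed
  ultimately show ?thesis by blast
qed

end
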